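(* Let $\Omega$ be a set with $n$ elements ($n\in\mathbb{N}$) and let $P=\{X_i\}_{i=1,\dots,k}$ be an ordered partition of $\Omega$, with order $X_1<X_2<\cdots<X_k$. Let $\pi=(|X_1|,\dots,|X_k|)$, an ordered partition of the integer $n$. Then the monoids $\mathcal{POI}_{\Omega,P}$ and $\mathcal{POI}_{\Omega_n,P_\pi}$ are isomorphic.
   Context: An ordered partition of a finite set $\Omega$ is a partition of $\Omega$ endowed with a linear order; writing $P=\{X_i\}_{i=1,\dots,k}$ means the order is $X_1<X_2<\cdots<X_k$. For $x\in\Omega$ let $i_x$ denote the index with $x\in X_{i_x}$. $\mathcal{POI}_{\Omega,P}$ is the monoid, under composition (maps written on the right, composed left to right), of all injective partial maps $\alpha$ from $\Omega$ to $\Omega$ (the empty map included) that are $P$-stable, i.e. $X_{i_x}\subseteq\mathrm{Dom}(\alpha)$ and $X_{i_x}\alpha=X_{i_{x\alpha}}$ for all $x\in\mathrm{Dom}(\alpha)$, and $P$-order preserving, i.e. $i_x\le i_y$ implies $i_{x\alpha}\le i_{y\alpha}$ for all $x,y\in\mathrm{Dom}(\alpha)$. An ordered partition of $n\in\mathbb{N}$ is a non-empty sequence of positive integers with sum $n$. $\Omega_n=\{1,\dots,n\}$. For an ordered partition $\pi=(n_1,\dots,n_k)$ of $n$, $P_\pi=\{I_i\}_{i=1,\dots,k}$ is the ordered partition of $\Omega_n$ into the intervals $I_1=\{1,\dots,n_1\}$ and $I_i=\{n_1+\cdots+n_{i-1}+1,\dots,n_1+\cdots+n_i\}$ for $2\le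 i\le k$, ordered by $I_1<\cdots<I_k$. *)

theory Defs
  imports "HOL-Algebra.Group" "HOL-Library.Disjoint_Sets"
begin

text \<open>The ordered partition \<open>X\<^sub>1 < \<dots> < X\<^sub>k\<close> is the list \<open>[X\<^sub>1, \<dots>, X\<^sub>k]\<close> of its blocks.\<close>

definition ordered_partition_on :: "'a set \<Rightarrow> 'a set list \<Rightarrow> bool"
  where "ordered_partition_on \<Omega> P \<longleftrightarrow> distinct P \<and> partition_on \<Omega> (set P)"

text \<open>Blocks are numbered from 0 rather than from 1, following list indexing; only equality and
  the order of indices are ever used.\<close>

definition block_index :: "'a set list \<Rightarrow> 'a \<Rightarrow> nat"
  where "block_index P x = (THE i. i < length P \<and> x \<in> P ! i)"

text \<open>Partial maps have type \<^typ>\<open>'a \<Rightarrow> 'a option\<close>; the value at a point \<open>x\<close> of the domain is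
  \<open>the (\<alpha> x)\<close>.\<close>

definition partition_stable :: "'a set list \<Rightarrow> ('a \<rightharpoonup> 'a) \<Rightarrow> bool"
  where "partition_stable P \<alpha> \<longleftrightarrow>
    (\<forall>x\<in>dom \<alpha>. P ! block_index P x \<subseteq> dom \<alpha> \<and>
       (\<lambda>y. the (\<alpha> y)) ` (P ! block_index P x) = P ! block_index P (the (\<alpha> x)))"

definition partition_order_preserving :: "'a set list \<Rightarrow> ('a \<rightharpoonup> 'a) \<Rightarrow> bool"
  where "partition_order_preserving P \<alpha> \<longleftrightarrow>
    (\<forall>x\<in>dom \<alpha>. \<forall>y\<in>dom \<alpha>. block_index P x \<le> block_index P y \<longrightarrow>
       block_index P (the (\<alpha> x)) \<le> block_index P (the (\<alpha> y)))"

text \<open>Maps are composed from left to right, hence the reversed arguments of \<open>\<circ>\<^sub>m\<close>.\<close>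

definition POI :: "'a set \<Rightarrow> 'a set list \<Rightarrow> ('a \<rightharpoonup> 'a) monoid"
  where "POI \<Omega> P =
    \<lparr>carrier = {\<alpha>. dom \<alpha> \<subseteq> \<Omega> \<and> ran \<alpha> \<subseteq> \<Omega> \<and> inj_on \<alpha> (dom \<alpha>) \<and>
                   partition_stable P \<alpha> \<and> partition_order_preserving P \<alpha>},
     monoid.mult = (\<lambda>\<alpha> \<beta>. \<beta> \<circ>\<^sub>m \<alpha>),
     one = Some |` \<Omega>\<rparr>"

definition ordered_partition_of :: "nat \<Rightarrow> nat list \<Rightarrow> bool"
  where "ordered_partition_of n \<pi> \<longleftrightarrow> \<pi> \<noteq> [] \<and> (\<forall>m\<in>set \<pi>. 0 < m) \<and> sum_list \<pi> = n"

definition interval_partition :: "nat list \<Rightarrow> nat set list"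
  where "interval_partition \<pi> =
    map (\<lambda>i. {sum_list (take i \<pi>) + 1 .. sum_list (take (Suc i) \<pi>)}) [0..<length \<pi>]"

lemma block_index_eqI:
  assumes "ordered_partition_on \<Omega> P" "i < length P" "x \<in> P ! i"
  shows "block_index P x = i"
  unfolding block_index_def
proof (rule the_equality)
  fix j assume j: "j < length P \<and> x \<in> P ! j"
  with assms have "P ! i = P ! j"
    unfolding ordered_partition_on_def partition_on_def disjoint_def
    by (metis IntI empty_iff nth_mem)
  with assms j show "j = i"
    by (simp add: ordered_partition_on_def nth_eq_iff_index_eq)
qed (use assms in simp)

lemma block_index:
  assumes "ordered_partition_on \<Omega> P" "x \<in> \<Omega>"
  shows "block_index P x < length P" "x \<in> P ! block_index P x"
proof -
  from assms obtain i where "i < length P" "x \<in> P ! i"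
    by (metis UnionE in_set_conv_nth ordered_partition_on_def partition_on_def)
  with block_index_eqI[OF assms(1)] show "block_index P x < length P" "x \<in> P ! block_index P x"
    by auto
qed

lemma ordered_partition_on_interval_partition:
  assumes "ordered_partition_of n \<pi>"
  shows "ordered_partition_on {1..n} (interval_partition \<pi>)"
proof -
  define s where "s i = sum_list (take i \<pi>)" for i
  have P: "interval_partition \<pi> = map (\<lambda>i. {s i + 1 .. s (Suc i)}) [0..<length \<pi>]"
    by (simp add: interval_partition_def s_def)
  have mono: "s i \<le> s j" if "i \<le> j" for i j
    using that by (auto simp: s_def take_add le_iff_add)
  have less: "s i < s (Suc i)" if "i < length \<pi>" for i
    using that assms by (simp add: s_def take_Suc_conv_app_nth ordered_partition_of_def)
  have disj: "{s i + 1 .. s (Suc i)} \<inter> {s j + 1 .. s (Suc j)} = {}" if "i \<noteq> j" for i j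
    using mono[of "Suc i" j] mono[of "Suc j" i] that by (auto simp: nat_neq_iff Suc_le_eq)
  have dist: "inj_on (\<lambda>i. {s i + 1 .. s (Suc i)}) {0..<length \<pi>}"
  proof (rule inj_onI, rule ccontr)
    fix i j assume *: "i \<in> {0..<length \<pi>}" "{s i + 1 .. s (Suc i)} = {s j + 1 .. s (Suc j)}" "i \<noteq> j"
    then have "{s i + 1 .. s (Suc i)} = {}" using disj[of i j] by auto
    with less[of i] * show False by auto
  qed
  have un: "(\<Union>i<k. {s i + 1 .. s (Suc i)}) = {1..s k}" for k
  proof (induction k)
    case 0 show ?case by (simp add: s_def)
  next
    case (Suc k)
    have "{1..s (Suc k)} = {1..s k} \<union> {s k + 1..s (Suc k)}" using mono[of k "Suc k"] by auto
    with Suc show ?case by (auto simp: lessThan_Suc)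
  qed
  have n: "s (length \<pi>) = n" using assms by (simp add: s_def ordered_partition_of_def)
  show ?thesis
    unfolding ordered_partition_on_def
  proof
    show "distinct (interval_partition \<pi>)" unfolding P distinct_map using dist by simp
    show "partition_on {1..n} (set (interval_partition \<pi>))"
    proof (rule partition_onI)
      show "\<Union> (set (interval_partition \<pi>)) = {1..n}"
        using un[of "length \<pi>"] n by (simp add: P atLeast0LessThan)
      show "{} \<notin> set (interval_partition \<pi>)" using less by (fastforce simp: P)
      fix p q assume p: "p \<in> set (interval_partition \<pi>)"
      assume "q \<in> set (interval_partition \<pi>)" "p \<noteq> q"
      with p obtain i j where "p = {s i + 1 .. s (Suc i)}" "q = {s j + 1 .. s (Suc j)}" "i \<noteq> j"
        by (auto simp: P)
      then show "disjnt p q" using disj by (simp add: disjnt_def)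
    qed
  qed
qed

lemma monoid_POI:
  assumes P: "ordered_partition_on \<Omega> P"
  shows "Group.monoid (POI \<Omega> P)"
proof (rule monoidI)
  fix \<alpha> \<beta> assume "\<alpha> \<in> carrier (POI \<Omega> P)" "\<beta> \<in> carrier (POI \<Omega> P)"
  then have a: "dom \<alpha> \<subseteq> \<Omega>" "ran \<alpha> \<subseteq> \<Omega>" "inj_on \<alpha> (dom \<alpha>)" "partition_stable P \<alpha>" "partition_order_preserving P \<alpha>"
    and b: "dom \<beta> \<subseteq> \<Omega>" "ran \<beta> \<subseteq> \<Omega>" "inj_on \<beta> (dom \<beta>)" "partition_stable P \<beta>" "partition_order_preserving P \<beta>"
    by (auto simp: POI_def)
  let ?c = "\<beta> \<circ>\<^sub>m \<alpha>"
  have c: "\<exists>y z. \<alpha> x = Some y \<and> \<beta> y = Some z \<and> ?c x = Some z" if "x \<in> dom ?c" for x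
    using that by (auto simp: map_comp_def split: option.splits)
  have "dom ?c \<subseteq> \<Omega>" using c a(1) by blast
  moreover have "ran ?c \<subseteq> \<Omega>"
    using b(2) by (auto simp: ran_def map_comp_def split: option.splits)
  moreover have "inj_on ?c (dom ?c)"
  proof (rule inj_onI)
    fix x x' assume x: "x \<in> dom ?c" "x' \<in> dom ?c" "?c x = ?c x'"
    from c[OF x(1)] c[OF x(2)] x(3) obtain y y' z
      where *: "\<alpha> x = Some y" "\<alpha> x' = Some y'" "\<beta> y = Some z" "\<beta> y' = Some z" by auto
    with b(3) have "y = y'" by (metis domI inj_onD)
    with * a(3) show "x = x'" by (metis domI inj_onD)
  qed
  moreover have "partition_stable P ?c"
    unfolding partition_stable_def
  proof
    fix x assume "x \<in> dom ?c"
    from c[OF this] obtain y z where x: "\<alpha> x = Some y" "\<beta> y = Some z" "?c x = Some z" by auto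
    let ?X = "P ! block_index P x" and ?Y = "P ! block_index P y"
    have A: "?X \<subseteq> dom \<alpha>" "(\<lambda>y. the (\<alpha> y)) ` ?X = ?Y"
      using a(4) x unfolding partition_stable_def by force+
    have B: "?Y \<subseteq> dom \<beta>" "(\<lambda>y. the (\<beta> y)) ` ?Y = P ! block_index P z"
      using b(4) x unfolding partition_stable_def by force+
    have C: "u \<in> dom ?c \<and> the (?c u) = the (\<beta> (the (\<alpha> u)))" if "u \<in> ?X" for u
    proof -
      from that A obtain v where "\<alpha> u = Some v" "v \<in> ?Y" by force
      with B show ?thesis by (auto simp: map_comp_def)
    qed
    have "(\<lambda>y. the (?c y)) ` ?X = (\<lambda>y. the (\<beta> y)) ` (\<lambda>y. the (\<alpha> y)) ` ?X"
      using C by (simp add: image_image)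
    with A B x have "(\<lambda>y. the (?c y)) ` ?X = P ! block_index P (the (?c x))" by simp
    with C show "?X \<subseteq> dom ?c \<and> (\<lambda>y. the (?c y)) ` ?X = P ! block_index P (the (?c x))"
      by blast
  qed
  moreover have "partition_order_preserving P ?c"
    unfolding partition_order_preserving_def
  proof (intro ballI impI)
    fix x x' assume x: "x \<in> dom ?c" "x' \<in> dom ?c" "block_index P x \<le> block_index P x'"
    from c[OF x(1)] c[OF x(2)] obtain y y' z z'
      where *: "\<alpha> x = Some y" "\<alpha> x' = Some y'" "\<beta> y = Some z" "\<beta> y' = Some z'"
        "?c x = Some z" "?c x' = Some z'" by auto
    with a(5) x(3) have "block_index P y \<le> block_index P y'"
      unfolding partition_order_preserving_def by (metis domI option.sel)
    with b(5) * show "block_index P (the (?c x)) \<le> block_index P (the (?c x'))"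
      unfolding partition_order_preserving_def by (metis domI option.sel)
  qed
  ultimately show "\<alpha> \<otimes>\<^bsub>POI \<Omega> P\<^esub> \<beta> \<in> carrier (POI \<Omega> P)" by (simp add: POI_def)
next
  have sub: "P ! block_index P x \<subseteq> \<Omega>" if "x \<in> \<Omega>" for x
    using block_index(1)[OF P that] P
    by (metis Sup_upper nth_mem ordered_partition_on_def partition_on_def)
  have dom: "dom (Some |` \<Omega>) = \<Omega>" by (auto simp: restrict_map_def split: if_splits)
  have "partition_stable P (Some |` \<Omega>)" 
    unfolding partition_stable_def dom
  proof
    fix x assume x: "x \<in> \<Omega>"
    have "(\<lambda>y. the ((Some |` \<Omega>) y)) ` (P ! block_index P x) = (\<lambda>y. y) ` (P ! block_index P x)"
      by (rule image_cong) (use sub[OF x] in auto)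
    with sub[OF x] x show "P ! block_index P x \<subseteq> \<Omega> \<and>
        (\<lambda>y. the ((Some |` \<Omega>) y)) ` (P ! block_index P x) = P ! block_index P (the ((Some |` \<Omega>) x))"
      by simp
  qed
  moreover have "partition_order_preserving P (Some |` \<Omega>)" by (simp add: partition_order_preserving_def dom)
  moreover have "inj_on (Some |` \<Omega>) \<Omega>" by (auto intro!: inj_onI)
  moreover have "ran (Some |` \<Omega>) \<subseteq> \<Omega>" by (auto simp: ran_def restrict_map_def split: if_splits)
  ultimately show "\<one>\<^bsub>POI \<Omega> P\<^esub> \<in> carrier (POI \<Omega> P)" by (simp add: POI_def dom)
next
  fix \<alpha> assume "\<alpha> \<in> carrier (POI \<Omega> P)"
  then have "dom \<alpha> \<subseteq> \<Omega>" "ran \<alpha> \<subseteq> \<Omega>" by (auto simp: POI_def)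
  then have "\<And>x. x \<notin> \<Omega> \<Longrightarrow> \<alpha> x = None" "\<And>x y. \<alpha> x = Some y \<Longrightarrow> y \<in> \<Omega>"
    by (auto simp: domIff ran_def)
  then show "\<one>\<^bsub>POI \<Omega> P\<^esub> \<otimes>\<^bsub>POI \<Omega> P\<^esub> \<alpha> = \<alpha>" "\<alpha> \<otimes>\<^bsub>POI \<Omega> P\<^esub> \<one>\<^bsub>POI \<Omega> P\<^esub> = \<alpha>"
    by (auto simp: POI_def map_comp_def restrict_map_def fun_eq_iff split: option.splits)
qed (auto simp: POI_def map_comp_def fun_eq_iff split: option.splits)

end

theory Submission
  imports Defs
begin

text \<open>
  Blocks with the same index have the same cardinality, so bijections between them glue to a
  bijection of the two sets that preserves block indices; conjugation by it is the isomorphism.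
\<close>

text \<open>Blocks become fibres of the index function, because the blocks cover
  \<open>\<Omega>\<close> and are pairwise disjoint. A map that preserves indices can then be seen
  to carry blocks to blocks.\<close>

lemma block_eq:
  assumes P: "ordered_partition_on \<Omega> P" and x: "x \<in> \<Omega>"
  shows "P ! block_index P x = {z \<in> \<Omega>. block_index P z = block_index P x}"
proof
  have "P ! block_index P x \<subseteq> \<Omega>"
    using P block_index(1)[OF P x]
    by (metis Sup_upper nth_mem ordered_partition_on_def partition_on_def)
  then show "P ! block_index P x \<subseteq> {z \<in> \<Omega>. block_index P z = block_index P x}"
    using block_index_eqI[OF P block_index(1)[OF P x]] by blast
  show "{z \<in> \<Omega>. block_index P z = block_index P x} \<subseteq> P ! block_index P x"
    using block_index(2)[OF P] by (auto; metis)
qed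

text \<open>Read from left to right this is \<open>g\<close>, then \<open>\<alpha>\<close>, then
  \<open>f\<close>. As \<open>g\<close> is a total function with arbitrary values off
  \<open>\<Omega>'\<close>, the restriction keeps stray points out of the domain.\<close>

definition conjugate :: "'b set \<Rightarrow> ('a \<Rightarrow> 'b) \<Rightarrow> ('b \<Rightarrow> 'a) \<Rightarrow> ('a \<rightharpoonup> 'a) \<Rightarrow> ('b \<rightharpoonup> 'b)"
  where "conjugate \<Omega>' f g \<alpha> = (\<lambda>y. map_option f (\<alpha> (g y))) |` \<Omega>'"

text \<open>The inverse \<open>g\<close> is a parameter in its own right, so that the two sides can
  be exchanged; \<open>f\<close> and \<open>g\<close> are mutually inverse only on
  \<open>\<Omega>\<close> and \<open>\<Omega>'\<close>.\<close>

locale block_isomorphism =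
  fixes \<Omega> :: "'a set" and P :: "'a set list" and \<Omega>' :: "'b set" and Q :: "'b set list"
    and f :: "'a \<Rightarrow> 'b" and g :: "'b \<Rightarrow> 'a"
  assumes P: "ordered_partition_on \<Omega> P"
    and Q: "ordered_partition_on \<Omega>' Q"
    and f_in: "x \<in> \<Omega> \<Longrightarrow> f x \<in> \<Omega>'"
    and g_in: "y \<in> \<Omega>' \<Longrightarrow> g y \<in> \<Omega>"
    and g_f: "x \<in> \<Omega> \<Longrightarrow> g (f x) = x"
    and f_g: "y \<in> \<Omega>' \<Longrightarrow> f (g y) = y"
    and index_f: "x \<in> \<Omega> \<Longrightarrow> block_index Q (f x) = block_index P x"
begin

lemma index_g: "y \<in> \<Omega>' \<Longrightarrow> block_index P (g y) = block_index Q y"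
  using index_f[of "g y"] by (simp add: g_in f_g)

text \<open>Every fact about conjugation from \<open>\<Omega>\<close> to \<open>\<Omega>'\<close>
  thereby yields the one in the opposite direction.\<close>

lemma block_isomorphism_sym: "block_isomorphism \<Omega>' Q \<Omega> P g f"
  by unfold_locales (fact Q P g_in f_in f_g g_f index_g)+

text \<open>Both sides are fibres of the index functions over the same index, and \<open>f\<close>,
  \<open>g\<close> restrict to inverse bijections between these fibres.\<close>

lemma image_block:
  assumes "x \<in> \<Omega>"
  shows "f ` (P ! block_index P x) = Q ! block_index P x"
proof -
  have "Q ! block_index P x = {y \<in> \<Omega>'. block_index Q y = block_index P x}"
    using block_eq[OF Q f_in[OF assms]] by (simp add: index_f assms)
  moreover have "f ` {z \<in> \<Omega>. block_index P z = i} = {y \<in> \<Omega>'. block_index Q y = i}" for i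
  proof (intro subset_antisym subsetI)
    fix y assume "y \<in> {y \<in> \<Omega>'. block_index Q y = i}"
    then show "y \<in> f ` {z \<in> \<Omega>. block_index P z = i}"
      by (intro image_eqI[where x = "g y"]) (auto simp: g_in index_g f_g)
  qed (auto simp: f_in index_f)
  ultimately show ?thesis using block_eq[OF P assms] by simp
qed

lemma conjugate_closed:
  assumes "\<alpha> \<in> carrier (POI \<Omega> P)"
  shows "conjugate \<Omega>' f g \<alpha> \<in> carrier (POI \<Omega>' Q)"
proof -
  let ?c = "conjugate \<Omega>' f g \<alpha>"
  from assms have dom: "dom \<alpha> \<subseteq> \<Omega>" and ran: "ran \<alpha> \<subseteq> \<Omega>" and inj: "inj_on \<alpha> (dom \<alpha>)"
    and st: "partition_stable P \<alpha>" and op: "partition_order_preserving P \<alpha>"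
    by (auto simp: POI_def)
  \<comment> \<open>The intermediate value \<open>z\<close> lies in \<open>\<Omega>\<close> because
    \<open>ran \<alpha> \<subseteq> \<Omega>\<close>; this is what makes \<open>g_f\<close>,
    \<open>index_f\<close> and \<open>image_block\<close> applicable to it below.\<close>
  have c: "\<exists>z\<in>\<Omega>. y \<in> \<Omega>' \<and> \<alpha> (g y) = Some z \<and> ?c y = Some (f z)" if "y \<in> dom ?c" for y
    using that subsetD[OF ran ranI]
    by (auto simp: conjugate_def restrict_map_def split: if_splits)
  have "dom ?c \<subseteq> \<Omega>'" using c by blast
  moreover have "ran ?c \<subseteq> \<Omega>'"
    using c f_in by (fastforce simp: ran_def)
  moreover have "inj_on ?c (dom ?c)"
  proof (rule inj_onI)
    fix x y assume x: "x \<in> dom ?c" and y: "y \<in> dom ?c" and "?c x = ?c y"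
    \<comment> \<open>Applying \<open>g\<close> to the equal values removes
      \<open>f\<close>.\<close>
    then have "\<alpha> (g x) = \<alpha> (g y)" "g x \<in> dom \<alpha>" "g y \<in> dom \<alpha>"
      using c[OF x] c[OF y] by (auto, metis g_f)
    then have "g x = g y" using inj by (auto dest: inj_onD)
    with c[OF x] c[OF y] show "x = y" by (metis f_g)
  qed
  moreover have "partition_stable Q ?c"
    unfolding partition_stable_def
  proof
    fix y assume "y \<in> dom ?c"
    from c[OF this] obtain z where z: "z \<in> \<Omega>" and y: "y \<in> \<Omega>'"
      and eq: "\<alpha> (g y) = Some z" "?c y = Some (f z)" by blast
    let ?X = "P ! block_index P (g y)" and ?Y = "Q ! block_index Q y"
    have X: "?X \<subseteq> dom \<alpha>" "(\<lambda>x. the (\<alpha> x)) ` ?X = P ! block_index P z"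
      using st eq unfolding partition_stable_def by force+
    have Y: "?Y = f ` ?X" using image_block[OF g_in[OF y]] index_g[OF y] by simp
    \<comment> \<open>On the block, \<open>f\<close> intertwines \<open>\<alpha>\<close> with its
      conjugate, since \<open>g\<close> undoes \<open>f\<close> there.\<close>
    have C: "f x \<in> dom ?c \<and> the (?c (f x)) = f (the (\<alpha> x))" if "x \<in> ?X" for x
    proof -
      from that X(1) dom have "x \<in> \<Omega>" "x \<in> dom \<alpha>" by auto
      then show ?thesis by (auto simp: conjugate_def f_in g_f)
    qed
    have "(\<lambda>x. the (?c x)) ` ?Y = f ` (\<lambda>x. the (\<alpha> x)) ` ?X"
      unfolding Y image_image using C by (intro image_cong) auto
    \<comment> \<open>Stability of \<open>\<alpha>\<close> turns \<open>?X\<close> into the block of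
      \<open>z\<close>, which \<open>f\<close> carries to the block of \<open>f z\<close>, the value
      of the conjugate at \<open>y\<close>.\<close>
    also have "\<dots> = Q ! block_index Q (the (?c y))"
      using image_block[OF z] index_f[OF z] X(2) eq by simp
    finally show "?Y \<subseteq> dom ?c \<and> (\<lambda>x. the (?c x)) ` ?Y = Q ! block_index Q (the (?c y))"
      using C Y by auto
  qed
  moreover have "partition_order_preserving Q ?c"
    unfolding partition_order_preserving_def
  proof (intro ballI impI)
    fix x y assume x: "x \<in> dom ?c" and y: "y \<in> dom ?c"
      and le: "block_index Q x \<le> block_index Q y"
    from c[OF x] c[OF y] obtain z w where *: "z \<in> \<Omega>" "w \<in> \<Omega>" "x \<in> \<Omega>'" "y \<in> \<Omega>'"
      "\<alpha> (g x) = Some z" "\<alpha> (g y) = Some w" "?c x = Some (f z)" "?c y = Some (f w)" by blast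
    with le have "block_index P (g x) \<le> block_index P (g y)" by (simp add: index_g)
    then have "block_index P z \<le> block_index P w"
      using op * unfolding partition_order_preserving_def by (metis domI option.sel)
    with * show "block_index Q (the (?c x)) \<le> block_index Q (the (?c y))"
      by (simp add: index_f)
  qed
  ultimately show ?thesis by (simp add: POI_def)
qed

text \<open>On \<open>\<Omega>\<close> the maps \<open>f\<close> and \<open>g\<close> cancel at the
  argument and at the value, which lies in \<open>\<Omega>\<close>. Off \<open>\<Omega>\<close> both
  sides are undefined.\<close>

lemma conjugate_inverse:
  assumes "\<alpha> \<in> carrier (POI \<Omega> P)"
  shows "conjugate \<Omega> g f (conjugate \<Omega>' f g \<alpha>) = \<alpha>"
proof
  fix x
  from assms have "dom \<alpha> \<subseteq> \<Omega>" "ran \<alpha> \<subseteq> \<Omega>" by (auto simp: POI_def)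
  then have "x \<notin> \<Omega> \<Longrightarrow> \<alpha> x = None" "\<And>y. \<alpha> x = Some y \<Longrightarrow> y \<in> \<Omega>"
    by (auto simp: domIff ran_def)
  then show "conjugate \<Omega> g f (conjugate \<Omega>' f g \<alpha>) x = \<alpha> x"
    by (cases "\<alpha> x") (auto simp: conjugate_def restrict_map_def f_in g_f)
qed

text \<open>Between the two factors on the right, \<open>f\<close> is followed by \<open>g\<close>;
  they cancel because the values of \<open>\<alpha>\<close> lie in \<open>\<Omega>\<close>.\<close>

lemma conjugate_mult:
  assumes "\<alpha> \<in> carrier (POI \<Omega> P)"
  shows "conjugate \<Omega>' f g (\<alpha> \<otimes>\<^bsub>POI \<Omega> P\<^esub> \<beta>) =
    conjugate \<Omega>' f g \<alpha> \<otimes>\<^bsub>POI \<Omega>' Q\<^esub> conjugate \<Omega>' f g \<beta>"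
proof
  fix y
  from assms have "z \<in> \<Omega>" if "\<alpha> x = Some z" for x z using that by (auto simp: POI_def ran_def)
  then show "conjugate \<Omega>' f g (\<alpha> \<otimes>\<^bsub>POI \<Omega> P\<^esub> \<beta>) y =
      (conjugate \<Omega>' f g \<alpha> \<otimes>\<^bsub>POI \<Omega>' Q\<^esub> conjugate \<Omega>' f g \<beta>) y"
    by (cases "\<alpha> (g y)") (auto simp: POI_def conjugate_def restrict_map_def map_comp_def f_in g_f)
qed

lemma POI_iso: "POI \<Omega> P \<cong> POI \<Omega>' Q"
proof -
  interpret sym: block_isomorphism \<Omega>' Q \<Omega> P g f by (rule block_isomorphism_sym)
  have "conjugate \<Omega>' f g \<in> iso (POI \<Omega> P) (POI \<Omega>' Q)"
  proof (rule isoI)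
    show "conjugate \<Omega>' f g \<in> hom (POI \<Omega> P) (POI \<Omega>' Q)"
      by (auto simp: hom_def conjugate_closed conjugate_mult)
    show "bij_betw (conjugate \<Omega>' f g) (carrier (POI \<Omega> P)) (carrier (POI \<Omega>' Q))"
      \<comment> \<open>The exchanged interpretation \<open>sym\<close> supplies closure and the
        second inverse law.\<close>
      by (rule bij_betw_byWitness[where f' = "conjugate \<Omega> g f"])
        (auto simp: conjugate_closed sym.conjugate_closed conjugate_inverse sym.conjugate_inverse)
  qed
  then show ?thesis by (auto simp: is_iso_def)
qed

end

lemma POI_iso_of_card_blocks:
  assumes P: "ordered_partition_on \<Omega> P" and Q: "ordered_partition_on \<Omega>' Q"
    and fin: "finite \<Omega>" "finite \<Omega>'" and card: "map card P = map card Q"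
  shows "POI \<Omega> P \<cong> POI \<Omega>' Q"
proof -
  have len: "length P = length Q" using card by (rule map_eq_imp_length_eq)
  have sub: "P ! i \<subseteq> \<Omega>" "Q ! i \<subseteq> \<Omega>'" if "i < length P" for i
    using that len P Q by (metis Sup_upper nth_mem ordered_partition_on_def partition_on_def)+
  have "\<exists>h. bij_betw h (P ! i) (Q ! i)" if i: "i < length P" for i
  proof (rule finite_same_card_bij)
    show "card (P ! i) = card (Q ! i)" using card i len by (metis nth_map)
  qed (use sub[OF i] fin in \<open>auto intro: finite_subset\<close>)
  then obtain h where h: "\<And>i. i < length P \<Longrightarrow> bij_betw (h i) (P ! i) (Q ! i)" by metis
  \<comment> \<open>The chosen bijections are glued: each point is moved by the one belonging to its
    own block.\<close>
  define f where "f x = h (block_index P x) x" for x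
  have f: "f x \<in> Q ! block_index P x" if "x \<in> \<Omega>" for x
    using h block_index[OF P that] unfolding f_def by (blast dest: bij_betwE)
  have index: "block_index Q (f x) = block_index P x" if "x \<in> \<Omega>" for x
    using block_index_eqI[OF Q _ f[OF that]] block_index(1)[OF P that] len by simp
  have f_in: "f x \<in> \<Omega>'" if "x \<in> \<Omega>" for x
    using f[OF that] sub(2) block_index(1)[OF P that] by blast
  have inj: "inj_on f \<Omega>"
  proof (rule inj_onI)
    fix x y assume x: "x \<in> \<Omega>" and y: "y \<in> \<Omega>" and eq: "f x = f y"
    \<comment> \<open>Equal images have equal indices, so both points lie in one block, where a
      single injective \<open>h i\<close> acts.\<close>
    then have i: "block_index P y = block_index P x" using index by metis
    with eq have "h (block_index P x) x = h (block_index P x) y" by (simp add: f_def)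
    with h[OF block_index(1)[OF P x]] block_index(2)[OF P x] block_index(2)[OF P y] i
    show "x = y" by (simp add: bij_betw_def inj_on_def)
  qed
  have surj: "y \<in> f ` \<Omega>" if y: "y \<in> \<Omega>'" for y
  proof -
    let ?i = "block_index Q y"
    \<comment> \<open>A preimage is sought in the block of \<open>P\<close> with the same number as
      the block of \<open>y\<close>.\<close>
    have i: "?i < length P" using block_index(1)[OF Q y] len by simp
    with h block_index(2)[OF Q y] obtain x where x: "x \<in> P ! ?i" "y = h ?i x"
      by (metis bij_betw_imp_surj_on imageE)
    then have "y = f x" "x \<in> \<Omega>"
      using block_index_eqI[OF P i] sub(1)[OF i] by (auto simp: f_def)
    then show ?thesis by blast
  qed
  interpret block_isomorphism \<Omega> P \<Omega>' Q f "inv_into \<Omega> f"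
    by unfold_locales (simp_all add: P Q f_in index inj surj inv_into_into f_inv_into_f)
  show ?thesis by (rule POI_iso)
qed

text \<open>Distinctness turns the list sum into a sum over the set of blocks, and disjointness
  turns that into the size of the union. Nonemptiness of \<open>\<Omega>\<close> rules out
  \<open>P = []\<close>.\<close>

lemma ordered_partition_of_map_card:
  assumes P: "ordered_partition_on \<Omega> P" and fin: "finite \<Omega>" and ne: "\<Omega> \<noteq> {}"
  shows "ordered_partition_of (card \<Omega>) (map card P)"
proof -
  have part: "distinct P" "\<Union> (set P) = \<Omega>" "disjoint (set P)" "{} \<notin> set P"
    using P by (auto simp: ordered_partition_on_def partition_on_def)
  have finB: "finite B" if "B \<in> set P" for B
    using that part(2) fin by (metis Sup_upper finite_subset)
  have "sum_list (map card P) = (\<Sum>B\<in>set P. card B)"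
    using part(1) by (simp add: sum_list_distinct_conv_sum_set)
  also have "\<dots> = card \<Omega>"
    using card_Union_disjoint[of "set P"] part finB
    by (simp add: pairwise_def disjnt_def disjoint_def)
  finally have "sum_list (map card P) = card \<Omega>" .
  then show ?thesis
    using ne part finB by (auto simp: ordered_partition_of_def card_gt_0_iff)
qed

text \<open>The endpoints of the interval numbered \<open>i\<close> are consecutive partial sums,
  which differ by \<open>\<pi> ! i\<close>.\<close>

lemma map_card_interval_partition: "map card (interval_partition \<pi>) = \<pi>"
  by (rule nth_equalityI) (auto simp: interval_partition_def take_Suc_conv_app_nth)

theorem theorem1p2:
  fixes \<Omega> :: "'a set" and P :: "'a set list" and \<pi> :: "nat list" and n :: nat
  assumes "1 \<le> n" and "finite \<Omega>" and "card \<Omega> = n"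
    and "ordered_partition_on \<Omega> P"
    and "\<pi> = map card P"
  shows "ordered_partition_of n \<pi> \<and> POI \<Omega> P \<cong> POI {1..n} (interval_partition \<pi>)"
proof
  have "\<Omega> \<noteq> {}" using assms by auto
  then show \<pi>: "ordered_partition_of n \<pi>"
    using ordered_partition_of_map_card assms by metis
  show "POI \<Omega> P \<cong> POI {1..n} (interval_partition \<pi>)"
    \<comment> \<open>The interval blocks have sizes \<open>\<pi>\<close>, which is
      \<open>map card P\<close> by hypothesis, so block sizes agree.\<close>
    using POI_iso_of_card_blocks[OF assms(4) ordered_partition_on_interval_partition[OF \<pi>]]
      assms by (simp add: map_card_interval_partition)
qed

end
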